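(* Let $t_0\in\mathbf{R}$, let $h \in C^1[t_0,\infty)$ satisfy $h(t)>0$ for all $t \ge t_0$, and set $H(t)=\int_{t_0}^t h(s)\,ds$. Assume that $$\int_{t_0}^\infty \left| 2 h'(t) + |h(t)|^2 \right| dt < \infty, \qquad \limsup_{t\to\infty} t\,h(t) < \infty,$$ and that, for some $\alpha\in(0,1)$, $H(t) = 2\alpha\log t + O(1)$ as $t \to \infty$. Then, for every nontrivial solution $(x(t),y(t))$ on $[t_0,\infty)$ of the linear system $$x' = y, \qquad y' = -x-h(t)y,$$ there exists $t_1 \ge t_0$ such that $\dim_{\rm B}\Gamma_{(x,y;t_1)}=\dfrac{2}{1+\alpha}$.
   Context: A solution is nontrivial if it is not identically $(0,0)$. For a solution $(x(t),y(t))$ and $t_1\ge t_0$, the solution curve is $\Gamma_{(x,y;t_1)} = \{ (x(t),y(t)) : t \ge t_1 \}\subset\mathbf{R}^2$. The notation $f(t)=O(1)$ as $t\to\infty$ means that there exist $M>0$ and $T$ such that $|f(t)|\le M$ for $t\ge T$. For a bounded set $\Gamma\subset\mathbf{R}^2$, the box-counting (Minkowski-Bouligand) dimension is $$\dim_{\rm B} \Gamma = 2 - \lim_{\varepsilon \to +0} \frac{\log|\Gamma_\varepsilon|}{\log \varepsilon},$$ where $\Gamma_\varepsilon = \{ (x,y) \in \mathbf{R}^2 : d((x,y),\Gamma) \le \varepsilon \}$, $d$ is the Euclidean distance, and $|\Gamma_\varepsilon|$ is the two-dimensional Lebesgue measure of $\Gamma_\varepsilon$. The assertion $\dim_{\rm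 B}\Gamma=d$ includes that the limit exists. *)

theory Defs
  imports "HOL-Analysis.Analysis" "HOL-Library.Landau_Symbols"
begin

text \<open>Derivatives are taken within \<open>[t0, \<infinity>)\<close>, hence one-sided at \<open>t0\<close>.\<close>

definition is_solution :: "real \<Rightarrow> (real \<Rightarrow> real) \<Rightarrow> (real \<Rightarrow> real) \<Rightarrow> (real \<Rightarrow> real) \<Rightarrow> bool" where
  "is_solution t0 h x y \<longleftrightarrow>
     (\<forall>t\<ge>t0. (x has_real_derivative y t) (at t within {t0..}) \<and>
             (y has_real_derivative (- x t - h t * y t)) (at t within {t0..}))"

definition nontrivial :: "real \<Rightarrow> (real \<Rightarrow> real) \<Rightarrow> (real \<Rightarrow> real) \<Rightarrow> bool" where
  "nontrivial t0 x y \<longleftrightarrow> \<not> (\<forall>t\<ge>t0. (x t, y t) = (0, 0))"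

definition solution_curve :: "(real \<Rightarrow> real) \<Rightarrow> (real \<Rightarrow> real) \<Rightarrow> real \<Rightarrow> (real \<times> real) set" where
  "solution_curve x y t1 = {(x t, y t) |t. t \<ge> t1}"

definition closed_nbhd :: "(real \<times> real) set \<Rightarrow> real \<Rightarrow> (real \<times> real) set" where
  "closed_nbhd \<Gamma> \<epsilon> = {p. infdist p \<Gamma> \<le> \<epsilon>}"

text \<open>A relation rather than a function, so that it asserts that the limit exists; the dimension
  is only defined for bounded sets, so boundedness is part of the assertion as well.\<close>

definition has_box_dim :: "(real \<times> real) set \<Rightarrow> real \<Rightarrow> bool" where
  "has_box_dim \<Gamma> d \<longleftrightarrow> bounded \<Gamma> \<and>
     (\<exists>L. ((\<lambda>\<epsilon>. ln (measure lebesgue (closed_nbhd \<Gamma> \<epsilon>)) / ln \<epsilon>) \<longlongrightarrow> L) (at_right 0) \<and>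
          d = 2 - L)"

end

theory Submission
  imports Defs "HOL-Real_Asymp.Real_Asymp"
begin

text \<open>Integrability of \<open>2 h' + h\<^sup>2\<close> forces \<open>\<bar>(x, y)\<bar>\<close> to be of exact order
  \<open>exp (- H t / 2)\<close>, that is, of order \<open>t powr -\<alpha>\<close>, while the curve turns with nearly unit
  angular speed. Given \<open>\<epsilon>\<close>, split the curve at \<open>T\<close> with \<open>\<epsilon> = T powr (-1 - \<alpha>)\<close>. The part after
  \<open>T\<close> lies in a disc of radius of order \<open>T powr -\<alpha>\<close>; the part before has length of order
  \<open>T powr (1 - \<alpha>)\<close>, so its neighbourhood has area of order \<open>\<epsilon> T powr (1 - \<alpha>)\<close>. Both areas are of
  order \<open>T powr (-2 \<alpha>) = \<epsilon> powr (2 \<alpha> / (1 + \<alpha>))\<close>. Conversely, successive turns after \<open>T\<close> are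
  only of order \<open>\<epsilon>\<close> apart, so a neighbourhood of width of order \<open>\<epsilon>\<close> contains a whole disc of
  radius of order \<open>T powr -\<alpha>\<close>.\<close>

section \<open>A mean value inequality\<close>

text \<open>Both \<open>g - f\<close> and \<open>g + f\<close> are nondecreasing. Derivatives may be
  one-sided at the ends, so interior derivatives are combined with continuity on the closed
  interval. The case \<open>f = 0\<close> later serves as a monotonicity criterion for such
  derivatives.\<close>

lemma abs_diff_le_of_deriv_le:
  fixes f g :: "real \<Rightarrow> real"
  assumes "a \<le> b"
    and f: "\<And>t. a \<le> t \<Longrightarrow> t \<le> b \<Longrightarrow> (f has_real_derivative f' t) (at t within {a..b})"
    and g: "\<And>t. a \<le> t \<Longrightarrow> t \<le> b \<Longrightarrow> (g has_real_derivative g' t) (at t within {a..b})"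
    and le: "\<And>t. a \<le> t \<Longrightarrow> t \<le> b \<Longrightarrow> \<bar>f' t\<bar> \<le> g' t"
  shows "\<bar>f b - f a\<bar> \<le> g b - g a"
proof -
  have cont: "continuous_on {a..b} f" "continuous_on {a..b} g"
    using f g by (auto intro!: DERIV_continuous_on)
  have at: "(f has_real_derivative f' t) (at t)" "(g has_real_derivative g' t) (at t)"
    if "a < t" "t < b" for t
    using f[of t] g[of t] that at_within_Icc_at[of a t b] by auto
  have "g a - f a \<le> g b - f b"
  proof (rule DERIV_nonneg_imp_increasing_open[OF \<open>a \<le> b\<close>])
    show "\<exists>d. ((\<lambda>t. g t - f t) has_real_derivative d) (at t) \<and> 0 \<le> d" if "a < t" "t < b" for t
      using at[OF that] le[of t] that
      by (intro exI[of _ "g' t - f' t"]) (auto intro!: derivative_eq_intros)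
  qed (intro continuous_intros cont)
  moreover have "g a + f a \<le> g b + f b"
  proof (rule DERIV_nonneg_imp_increasing_open[OF \<open>a \<le> b\<close>])
    show "\<exists>d. ((\<lambda>t. g t + f t) has_real_derivative d) (at t) \<and> 0 \<le> d" if "a < t" "t < b" for t
      using at[OF that] le[of t] that
      by (intro exI[of _ "g' t + f' t"]) (auto intro!: derivative_eq_intros)
  qed (intro continuous_intros cont)
  ultimately show ?thesis by linarith
qed

section \<open>Neighbourhoods of plane sets, their area and box dimension\<close>

lemma closed_closed_nbhd: "closed (closed_nbhd \<Gamma> \<epsilon>)"
  unfolding closed_nbhd_def by (intro closed_Collect_le continuous_intros)

text \<open>The infimum in \<open>infdist\<close> need not be attained on a set that is not closed;
  hence the slack between \<epsilon> and \<delta>.\<close>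

lemma closed_nbhd_witness:
  assumes "p \<in> closed_nbhd \<Gamma> \<epsilon>" "\<Gamma> \<noteq> {}" "\<epsilon> < \<delta>"
  obtains q where "q \<in> \<Gamma>" "dist p q < \<delta>"
proof -
  have "infdist p \<Gamma> < \<delta>"
    using assms by (simp add: closed_nbhd_def)
  then show thesis
    using assms(2) that by (auto simp: infdist_notempty cINF_less_iff)
qed

lemma bounded_closed_nbhd:
  assumes "bounded \<Gamma>" "\<Gamma> \<noteq> {}"
  shows "bounded (closed_nbhd \<Gamma> \<epsilon>)"
proof -
  obtain B where B: "\<And>q. q \<in> \<Gamma> \<Longrightarrow> norm q \<le> B"
    using assms(1) bounded_iff by blast
  have "norm p \<le> B + (\<bar>\<epsilon>\<bar> + 1)" if "p \<in> closed_nbhd \<Gamma> \<epsilon>" for p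
  proof -
    obtain q where q: "q \<in> \<Gamma>" "dist p q < \<bar>\<epsilon>\<bar> + 1"
      by (rule closed_nbhd_witness[OF \<open>p \<in> closed_nbhd \<Gamma> \<epsilon>\<close> assms(2), of "\<bar>\<epsilon>\<bar> + 1"]) auto
    then show ?thesis
      using B[OF q(1)] norm_triangle_ineq[of "p - q" q] by (simp add: dist_norm)
  qed
  then show ?thesis unfolding bounded_iff by blast
qed

lemma closed_nbhd_lmeasurable:
  assumes "bounded \<Gamma>" "\<Gamma> \<noteq> {}"
  shows "closed_nbhd \<Gamma> \<epsilon> \<in> lmeasurable"
  using assms by (intro lmeasurable_compact)
    (simp add: compact_eq_bounded_closed closed_closed_nbhd bounded_closed_nbhd)

lemma measure_cball_plane:
  fixes z :: "real \<times> real"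
  assumes "0 \<le> r"
  shows "measure lebesgue (cball z r) = pi * r\<^sup>2"
  using content_cball[OF assms, of z] by (simp add: eval_unit_ball_vol power2_eq_square)

text \<open>After taking logarithms, the constants contribute only
  \<open>ln c / ln \<epsilon>\<close> and \<open>ln C / ln \<epsilon>\<close>, which tend to
  0.\<close>

lemma has_box_dim_of_measure_powr_bounds:
  assumes "bounded \<Gamma>" and "0 < c"
    and bounds: "\<forall>\<^sub>F \<epsilon> in at_right 0. c * \<epsilon> powr \<beta> \<le> measure lebesgue (closed_nbhd \<Gamma> \<epsilon>) \<and>
      measure lebesgue (closed_nbhd \<Gamma> \<epsilon>) \<le> C * \<epsilon> powr \<beta>"
  shows "has_box_dim \<Gamma> (2 - \<beta>)"
proof -
  let ?m = "\<lambda>\<epsilon>. measure lebesgue (closed_nbhd \<Gamma> \<epsilon>)"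
  have small: "\<forall>\<^sub>F \<epsilon> in at_right 0. 0 < \<epsilon> \<and> \<epsilon> < (1::real)"
    unfolding eventually_at_right_field by (intro exI[of _ 1]) auto
  have lims: "((\<lambda>\<epsilon>. (ln c + \<beta> * ln \<epsilon>) / ln \<epsilon>) \<longlongrightarrow> \<beta>) (at_right 0)"
    "((\<lambda>\<epsilon>. (ln C + \<beta> * ln \<epsilon>) / ln \<epsilon>) \<longlongrightarrow> \<beta>) (at_right 0)"
    by real_asymp+
  \<comment> \<open>Division by the negative number \<open>ln \<epsilon>\<close> reverses
    inequalities, so the upper area bound supplies the lower member of the sandwich.\<close>
  have "\<forall>\<^sub>F \<epsilon> in at_right 0. (ln C + \<beta> * ln \<epsilon>) / ln \<epsilon> \<le> ln (?m \<epsilon>) / ln \<epsilon> \<and>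
      ln (?m \<epsilon>) / ln \<epsilon> \<le> (ln c + \<beta> * ln \<epsilon>) / ln \<epsilon>"
    using bounds small
  proof eventually_elim
    case (elim \<epsilon>)
    have pos: "0 < \<epsilon> powr \<beta>" "0 < ?m \<epsilon>"
      using elim \<open>0 < c\<close> by (auto intro: less_le_trans[of 0 "c * \<epsilon> powr \<beta>"])
    with elim have "0 < C * \<epsilon> powr \<beta>"
      by linarith
    with pos have "0 < C"
      by (simp add: zero_less_mult_iff)
    have "ln (c * \<epsilon> powr \<beta>) \<le> ln (?m \<epsilon>)" "ln (?m \<epsilon>) \<le> ln (C * \<epsilon> powr \<beta>)"
      using elim pos \<open>0 < c\<close> \<open>0 < C\<close> by auto
    then have "ln c + \<beta> * ln \<epsilon> \<le> ln (?m \<epsilon>)" "ln (?m \<epsilon>) \<le> ln C + \<beta> * ln \<epsilon>"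
      using \<open>0 < c\<close> \<open>0 < C\<close> elim by (auto simp: ln_mult)
    then show ?case
      using elim by (auto intro!: divide_right_mono_neg)
  qed
  then have "((\<lambda>\<epsilon>. ln (?m \<epsilon>) / ln \<epsilon>) \<longlongrightarrow> \<beta>) (at_right 0)"
    by (intro tendsto_sandwich[OF _ _ lims(2) lims(1)]) (auto elim: eventually_mono)
  then show ?thesis
    using assms(1) by (auto simp: has_box_dim_def)
qed

section \<open>Covering Lipschitz curves, and plane rotations\<close>

text \<open>The centres are sample points with parameter spacing \<epsilon>; every parameter lies at
  most \<epsilon> to the right of one of them.\<close>

lemma lipschitz_image_cover:
  fixes f :: "real \<Rightarrow> 'a::metric_space"
  assumes "a \<le> b" "0 < \<epsilon>"
    and lip: "\<And>s t. a \<le> s \<Longrightarrow> s \<le> t \<Longrightarrow> t \<le> b \<Longrightarrow> dist (f s) (f t) \<le> L * (t - s)"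
    and "0 \<le> L"
  obtains Q where "finite Q" "real (card Q) \<le> (b - a) / \<epsilon> + 1"
    "f ` {a..b} \<subseteq> (\<Union>q\<in>Q. cball q (L * \<epsilon>))"
proof
  define n where "n = nat \<lfloor>(b - a) / \<epsilon>\<rfloor>"
  let ?Q = "(\<lambda>i. f (a + real i * \<epsilon>)) ` {..n}"
  show "finite ?Q" by simp
  have "real n \<le> (b - a) / \<epsilon>"
    using assms(1,2) by (simp add: n_def of_nat_floor)
  moreover have "card ?Q \<le> n + 1"
    using card_image_le[of "{..n}"] by simp
  ultimately show "real (card ?Q) \<le> (b - a) / \<epsilon> + 1"
    by linarith
  show "f ` {a..b} \<subseteq> (\<Union>q\<in>?Q. cball q (L * \<epsilon>))"
  proof
    fix z assume "z \<in> f ` {a..b}"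
    then obtain t where t: "a \<le> t" "t \<le> b" "z = f t" by auto
    define i where "i = nat \<lfloor>(t - a) / \<epsilon>\<rfloor>"
    have "real i \<le> (t - a) / \<epsilon>" "(t - a) / \<epsilon> < real i + 1"
      using t assms(2) by (simp_all add: i_def of_nat_floor) 
    then have i: "a + real i * \<epsilon> \<le> t" "t - (a + real i * \<epsilon>) \<le> \<epsilon>"
      using assms(2) by (simp_all add: field_simps)
    have "i \<le> n"
      unfolding i_def n_def using t assms(2) by (intro nat_mono floor_mono divide_right_mono) auto
    have "dist (f (a + real i * \<epsilon>)) z \<le> L * (t - (a + real i * \<epsilon>))"
      using lip[of "a + real i * \<epsilon>" t] i t assms(2) by simp
    also have "\<dots> \<le> L * \<epsilon>"
      using i \<open>0 \<le> L\<close> by (intro mult_left_mono)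
    finally show "z \<in> (\<Union>q\<in>?Q. cball q (L * \<epsilon>))"
      using \<open>i \<le> n\<close> by auto
  qed
qed

text \<open>The angle is the argument of the quotient of \<open>x\<^sub>0 + i y\<^sub>0\<close> by
  \<open>a + i b\<close>. The rotation is clockwise because this is the flow of the undamped system
  \<open>x' = y, y' = -x\<close>.\<close>

lemma ex_rotation:
  fixes x\<^sub>0 y\<^sub>0 a b :: real
  assumes "x\<^sub>0\<^sup>2 + y\<^sub>0\<^sup>2 = a\<^sup>2 + b\<^sup>2"
  obtains \<tau> where "0 \<le> \<tau>" "\<tau> \<le> 2 * pi"
    "a = cos \<tau> * x\<^sub>0 + sin \<tau> * y\<^sub>0" "b = - sin \<tau> * x\<^sub>0 + cos \<tau> * y\<^sub>0"
proof (cases "a\<^sup>2 + b\<^sup>2 = 0")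
  case True
  then show ?thesis using that[of 0] assms by simp
next
  case False
  define R where "R = a\<^sup>2 + b\<^sup>2"
  have R: "R \<noteq> 0" "x\<^sub>0\<^sup>2 + y\<^sub>0\<^sup>2 = R" using False assms by (auto simp: R_def)
  \<comment> \<open>Lagrange's identity: the modulus is multiplicative.\<close>
  have "(a * x\<^sub>0 + b * y\<^sub>0)\<^sup>2 + (a * y\<^sub>0 - b * x\<^sub>0)\<^sup>2 = (a\<^sup>2 + b\<^sup>2) * (x\<^sub>0\<^sup>2 + y\<^sub>0\<^sup>2)"
    by algebra
  also have "\<dots> = R\<^sup>2"
    using R by (simp add: R_def power2_eq_square)
  finally have "((a * x\<^sub>0 + b * y\<^sub>0) / R)\<^sup>2 + ((a * y\<^sub>0 - b * x\<^sub>0) / R)\<^sup>2 = 1"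
    using R by (simp add: power_divide flip: add_divide_distrib)
  then obtain \<tau> where \<tau>: "0 \<le> \<tau>" "\<tau> < 2 * pi"
    "(a * x\<^sub>0 + b * y\<^sub>0) / R = cos \<tau>" "(a * y\<^sub>0 - b * x\<^sub>0) / R = sin \<tau>"
    by (rule sincos_total_2pi)
  have "cos \<tau> * x\<^sub>0 + sin \<tau> * y\<^sub>0 = a * (x\<^sub>0\<^sup>2 + y\<^sub>0\<^sup>2) / R"
    "- sin \<tau> * x\<^sub>0 + cos \<tau> * y\<^sub>0 = b * (x\<^sub>0\<^sup>2 + y\<^sub>0\<^sup>2) / R"
    using R(1) by (simp_all add: field_simps power2_eq_square flip: \<tau>(3,4))
  then show ?thesis
    using that[of \<tau>] \<tau> R by simp
qed

lemma norm_Pair_le_abs: "norm (a, b) \<le> \<bar>a\<bar> + \<bar>b\<bar>" for a b :: real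
  using sqrt_sum_squares_le_sum_abs[of a b] by (simp add: norm_Pair)

lemma powr_square: "(t powr a)\<^sup>2 = t powr (2 * a)" for a t :: real
  by (simp add: power2_eq_square flip: powr_add)

section \<open>Box dimension of a spiral of radius of order t powr -\<alpha>\<close>

text \<open>This is the interface between the asymptotic analysis and the geometry: besides the
  equations, only \<open>h = O(1/t)\<close> and the exact order of the norm enter. Starting at
  \<open>t\<^sub>1 \<ge> 1\<close> makes powers of \<open>t\<close> monotone in the exponent and
  gives \<open>K / t \<le> K\<close>.\<close>

locale damped_spiral =
  fixes x y h :: "real \<Rightarrow> real" and t\<^sub>1 \<alpha> c C K :: real
  assumes t1: "1 \<le> t\<^sub>1"
    and alpha: "0 < \<alpha>" "\<alpha> < 1"
    and c_pos: "0 < c"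
    and x_deriv: "t\<^sub>1 \<le> t \<Longrightarrow> (x has_real_derivative y t) (at t)"
    and y_deriv: "t\<^sub>1 \<le> t \<Longrightarrow> (y has_real_derivative (- x t - h t * y t)) (at t)"
    and h_le: "t\<^sub>1 \<le> t \<Longrightarrow> \<bar>h t\<bar> \<le> K / t"
    and norm_ge: "t\<^sub>1 \<le> t \<Longrightarrow> c * t powr - \<alpha> \<le> norm (x t, y t)"
    and norm_le: "t\<^sub>1 \<le> t \<Longrightarrow> norm (x t, y t) \<le> C * t powr - \<alpha>"
begin

abbreviation "\<Gamma> \<equiv> solution_curve x y t\<^sub>1"

lemma C_pos: "0 < C"
proof -
  have "0 < c * t\<^sub>1 powr - \<alpha>" using c_pos t1 by simp
  also have "\<dots> \<le> C * t\<^sub>1 powr - \<alpha>" using norm_ge[of t\<^sub>1] norm_le[of t\<^sub>1] by simp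
  finally show ?thesis by (simp add: zero_less_mult_iff)
qed

lemma K_nonneg: "0 \<le> K"
proof -
  have "0 \<le> K / t\<^sub>1" using h_le[of t\<^sub>1] by linarith
  then show ?thesis using t1 by (simp add: zero_le_divide_iff)
qed

lemma abs_le: "t\<^sub>1 \<le> t \<Longrightarrow> \<bar>x t\<bar> \<le> C * t powr - \<alpha>" "t\<^sub>1 \<le> t \<Longrightarrow> \<bar>y t\<bar> \<le> C * t powr - \<alpha>"
  using norm_le[of t] norm_fst_le[of "x t" "y t"] norm_snd_le[of "y t" "x t"] by auto

lemma curve_nonempty: "\<Gamma> \<noteq> {}"
  by (auto simp: solution_curve_def)

lemma curve_bounded: "bounded \<Gamma>"
proof -
  have "norm (x t, y t) \<le> C" if "t\<^sub>1 \<le> t" for t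
  proof -
    have "t powr - \<alpha> \<le> t powr 0"
      using that t1 alpha by (intro powr_mono) auto
    then have "C * t powr - \<alpha> \<le> C * 1"
      using that t1 C_pos by (intro mult_left_mono) auto
    then show ?thesis using norm_le[OF that] by simp
  qed
  then show ?thesis
    by (auto simp: bounded_iff solution_curve_def)
qed

text \<open>Bounding by the earlier time \<open>s\<close> makes the estimate uniform over a whole
  revolution starting at \<open>s\<close>.\<close>

lemma abs_hy_le:
  assumes "t\<^sub>1 \<le> s" "s \<le> t"
  shows "\<bar>h t * y t\<bar> \<le> K * C * s powr (- 1 - \<alpha>)"
proof -
  have "\<bar>h t * y t\<bar> \<le> K / t * (C * t powr - \<alpha>)"
    unfolding abs_mult using assms h_le[of t] abs_le[of t] K_nonneg t1
    by (intro mult_mono) auto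
  also have "\<dots> = K * C * t powr (- 1 - \<alpha>)"
    using assms t1 by (simp add: powr_diff powr_minus field_simps)
  also have "\<dots> \<le> K * C * s powr (- 1 - \<alpha>)"
    using assms t1 alpha K_nonneg C_pos by (intro mult_left_mono powr_mono2') auto
  finally show ?thesis .
qed

text \<open>Undoing the rotation turns the system into one with right-hand side of size
  \<open>\<bar>h y\<bar> = O(t powr (-1 - \<alpha>))\<close>.\<close>

lemma dist_rotation_le:
  assumes s: "t\<^sub>1 \<le> s" and \<tau>: "0 \<le> \<tau>" "\<tau> \<le> 2 * pi"
  shows "dist (x (s + \<tau>), y (s + \<tau>)) (cos \<tau> * x s + sin \<tau> * y s, - sin \<tau> * x s + cos \<tau> * y s)
    \<le> 8 * pi * K * C * s powr (- 1 - \<alpha>)"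
proof -
  define M where "M = K * C * s powr (- 1 - \<alpha>)"
  \<comment> \<open>\<open>A\<close> and \<open>B\<close> are the coordinates in the frame that
    turns with the undamped flow. Their derivatives are \<open>sin \<tau>\<close> and
    \<open>- cos \<tau>\<close> times the damping term \<open>h y\<close>.\<close>
  define A where "A = (\<lambda>\<tau>. cos \<tau> * x (s + \<tau>) - sin \<tau> * y (s + \<tau>))"
  define B where "B = (\<lambda>\<tau>. sin \<tau> * x (s + \<tau>) + cos \<tau> * y (s + \<tau>))"
  have M: "0 \<le> M" using K_nonneg C_pos by (simp add: M_def)
  have shift: "((\<lambda>\<tau>. x (s + \<tau>)) has_real_derivative y (s + \<tau>)) (at \<tau>)"
    "((\<lambda>\<tau>. y (s + \<tau>)) has_real_derivative (- x (s + \<tau>) - h (s + \<tau>) * y (s + \<tau>))) (at \<tau>)"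
    if "0 \<le> \<tau>" for \<tau>
    using x_deriv[of "\<tau> + s"] y_deriv[of "\<tau> + s"] s that
    by (auto simp: DERIV_shift add.commute[of s])
  have hy: "\<bar>h (s + \<tau>) * y (s + \<tau>)\<bar> \<le> M" if "0 \<le> \<tau>" for \<tau>
    unfolding M_def using s that by (intro abs_hy_le) auto
  have lin: "((\<lambda>\<sigma>. M * \<sigma>) has_real_derivative M) (at \<sigma> within S)" for \<sigma> S
    by (auto intro!: derivative_eq_intros)
  have trig: "\<bar>u * (h (s + \<sigma>) * y (s + \<sigma>))\<bar> \<le> M" if "\<bar>u\<bar> \<le> 1" "0 \<le> \<sigma>" for u \<sigma>
    using mult_mono[OF that(1) hy[OF that(2)]] by (simp add: abs_mult)
  have "\<bar>A \<tau> - A 0\<bar> \<le> M * \<tau> - M * 0"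
  proof (rule abs_diff_le_of_deriv_le[OF \<tau>(1) _ lin])
    show "(A has_real_derivative sin \<sigma> * (h (s + \<sigma>) * y (s + \<sigma>))) (at \<sigma> within {0..\<tau>})"
      if "0 \<le> \<sigma>" for \<sigma>
      unfolding A_def
      by (rule DERIV_subset[OF _ subset_UNIV])
        (use shift[OF that] in \<open>auto intro!: derivative_eq_intros simp: algebra_simps\<close>)
  qed (auto intro!: trig)
  moreover have "\<bar>B \<tau> - B 0\<bar> \<le> M * \<tau> - M * 0"
  proof (rule abs_diff_le_of_deriv_le[OF \<tau>(1) _ lin])
    show "(B has_real_derivative - cos \<sigma> * (h (s + \<sigma>) * y (s + \<sigma>))) (at \<sigma> within {0..\<tau>})"
      if "0 \<le> \<sigma>" for \<sigma>
      unfolding B_def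
      by (rule DERIV_subset[OF _ subset_UNIV])
        (use shift[OF that] in \<open>auto intro!: derivative_eq_intros simp: algebra_simps\<close>)
  qed (auto intro!: trig[of "- cos _", simplified])
  moreover have "M * \<tau> \<le> M * (2 * pi)"
    using \<tau> M by (intro mult_left_mono)
  ultimately have AB: "\<bar>A \<tau> - x s\<bar> \<le> 2 * pi * M" "\<bar>B \<tau> - y s\<bar> \<le> 2 * pi * M"
    by (simp_all add: A_def B_def mult.commute)
  \<comment> \<open>Rotating back. The factor
    \<open>(sin \<tau>)\<^sup>2 + (cos \<tau>)\<^sup>2\<close> is kept explicit so that the
    identities are purely polynomial.\<close>
  have "cos \<tau> * A \<tau> + sin \<tau> * B \<tau> = ((sin \<tau>)\<^sup>2 + (cos \<tau>)\<^sup>2) * x (s + \<tau>)"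
    "- sin \<tau> * A \<tau> + cos \<tau> * B \<tau> = ((sin \<tau>)\<^sup>2 + (cos \<tau>)\<^sup>2) * y (s + \<tau>)"
    unfolding A_def B_def by algebra+
  then have diff: "x (s + \<tau>) - (cos \<tau> * x s + sin \<tau> * y s)
      = cos \<tau> * (A \<tau> - x s) + sin \<tau> * (B \<tau> - y s)"
    "y (s + \<tau>) - (- sin \<tau> * x s + cos \<tau> * y s)
      = - sin \<tau> * (A \<tau> - x s) + cos \<tau> * (B \<tau> - y s)"
    by (simp_all add: algebra_simps)
  have comb: "\<bar>u * a + v * b\<bar> \<le> \<bar>a\<bar> + \<bar>b\<bar>" if "\<bar>u\<bar> \<le> 1" "\<bar>v\<bar> \<le> 1" for u v a b :: real
    using mult_right_mono[OF that(1), of "\<bar>a\<bar>"] mult_right_mono[OF that(2), of "\<bar>b\<bar>"]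
      abs_triangle_ineq[of "u * a" "v * b"] by (simp add: abs_mult)
  \<comment> \<open>Each coordinate of the error has two terms of size at most
    \<open>2 * pi * M\<close>; adding the two coordinates gives the constant
    \<open>8 * pi\<close>.\<close>
  have "\<bar>cos \<tau> * (A \<tau> - x s) + sin \<tau> * (B \<tau> - y s)\<bar> \<le> 4 * pi * M"
    "\<bar>- sin \<tau> * (A \<tau> - x s) + cos \<tau> * (B \<tau> - y s)\<bar> \<le> 4 * pi * M"
    using comb[of "cos \<tau>" "sin \<tau>" "A \<tau> - x s" "B \<tau> - y s"]
      comb[of "- sin \<tau>" "cos \<tau>" "A \<tau> - x s" "B \<tau> - y s"] AB by auto
  then show ?thesis
    using norm_Pair_le_abs[of "x (s + \<tau>) - (cos \<tau> * x s + sin \<tau> * y s)"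
      "y (s + \<tau>) - (- sin \<tau> * x s + cos \<tau> * y s)"]
    unfolding dist_norm diff_Pair diff M_def by simp
qed

lemma norm_tendsto_0: "((\<lambda>t. norm (x t, y t)) \<longlongrightarrow> 0) at_top"
proof (rule tendsto_sandwich[where f = "\<lambda>_. 0"])
  show "((\<lambda>t. C * t powr - \<alpha>) \<longlongrightarrow> 0) at_top"
    using alpha by real_asymp
  show "\<forall>\<^sub>F t in at_top. norm (x t, y t) \<le> C * t powr - \<alpha>"
    using eventually_ge_at_top[of t\<^sub>1] by eventually_elim (rule norm_le)
qed auto

text \<open>The curve crosses the circle through a given point, and then runs along this circle up to
  a small error, passing near the given point within one revolution.\<close>

lemma cball_subset_closed_nbhd:
  assumes T: "t\<^sub>1 \<le> T" and D: "8 * pi * K * C \<le> D" "0 < D"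
  shows "cball 0 (c * T powr - \<alpha>) \<subseteq> closed_nbhd \<Gamma> (D * T powr (- 1 - \<alpha>))"
proof
  fix p :: "real \<times> real"
  assume "p \<in> cball 0 (c * T powr - \<alpha>)"
  then have p: "norm p \<le> norm (x T, y T)"
    using norm_ge[OF T] by simp
  have T_pos: "0 < T" using T t1 by simp
  have "\<exists>t\<ge>t\<^sub>1. dist p (x t, y t) \<le> D * T powr (- 1 - \<alpha>)"
  proof (cases "p = 0")
    case True
    \<comment> \<open>The curve never meets the origin, but converges to it.\<close>
    have "\<forall>\<^sub>F t in at_top. norm (x t, y t) < D * T powr (- 1 - \<alpha>)"
      using norm_tendsto_0 D T_pos by (intro order_tendstoD) auto
    then have "\<forall>\<^sub>F t in at_top. t\<^sub>1 \<le> t \<and> norm (x t, y t) < D * T powr (- 1 - \<alpha>)"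
      by (intro eventually_conj eventually_ge_at_top)
    then show ?thesis
      using True by (auto simp: eventually_at_top_linorder dist_commute[of 0] intro: less_imp_le)
  next
    case False
    then have "\<forall>\<^sub>F t in at_top. norm (x t, y t) < norm p"
      using norm_tendsto_0 by (intro order_tendstoD) auto
    then have "\<forall>\<^sub>F t in at_top. T \<le> t \<and> norm (x t, y t) < norm p"
      by (intro eventually_conj eventually_ge_at_top)
    then obtain T' where T': "T \<le> T'" "norm (x T', y T') < norm p"
      by (auto simp: eventually_at_top_linorder)
    have "continuous_on {T..T'} x" "continuous_on {T..T'} y"
      using DERIV_isCont[OF x_deriv] DERIV_isCont[OF y_deriv] T
      by (auto intro!: continuous_at_imp_continuous_on)
    then have "continuous_on {T..T'} (\<lambda>t. norm (x t, y t))"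
      by (intro continuous_intros)
    \<comment> \<open>The norm is at least \<open>norm p\<close> at \<open>T\<close> and smaller at
      \<open>T'\<close>, so the curve crosses the circle through \<open>p\<close> in
      between.\<close>
    then obtain s where s: "T \<le> s" "norm (x s, y s) = norm p"
      using IVT2'[of "\<lambda>t. norm (x t, y t)" T' "norm p" T] p T' by auto
    obtain a b where ab: "p = (a, b)" by (cases p)
    have "(x s)\<^sup>2 + (y s)\<^sup>2 = a\<^sup>2 + b\<^sup>2"
      using s(2) by (simp add: ab norm_Pair)
    then obtain \<tau> where \<tau>: "0 \<le> \<tau>" "\<tau> \<le> 2 * pi"
      "a = cos \<tau> * x s + sin \<tau> * y s" "b = - sin \<tau> * x s + cos \<tau> * y s"
      by (rule ex_rotation)
    have "dist (x (s + \<tau>), y (s + \<tau>)) p \<le> 8 * pi * K * C * s powr (- 1 - \<alpha>)"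
      using dist_rotation_le[of s \<tau>] s T \<tau> by (simp add: ab)
    also have "\<dots> \<le> D * T powr (- 1 - \<alpha>)"
      using D s T_pos alpha by (intro mult_mono powr_mono2') auto
    finally show ?thesis
      using s \<tau> T by (intro exI[of _ "s + \<tau>"]) (auto simp: dist_commute)
  qed
  then obtain t where t: "t\<^sub>1 \<le> t" "dist p (x t, y t) \<le> D * T powr (- 1 - \<alpha>)" by blast
  then have "(x t, y t) \<in> \<Gamma>" by (auto simp: solution_curve_def)
  then show "p \<in> closed_nbhd \<Gamma> (D * T powr (- 1 - \<alpha>))"
    using infdist_le2[of _ \<Gamma> p] t by (auto simp: closed_nbhd_def)
qed

text \<open>The speed is of order \<open>t powr -\<alpha>\<close>, so \<open>t powr (1 - \<alpha>)\<close> behaves like arc length.\<close>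

lemma dist_curve_le:
  assumes "t\<^sub>1 \<le> s" "s \<le> t"
  shows "dist (x s, y s) (x t, y t)
    \<le> 2 * (1 + K) * C / (1 - \<alpha>) * (t powr (1 - \<alpha>) - s powr (1 - \<alpha>))"
proof -
  \<comment> \<open>An antiderivative of a common bound for both velocity components:
    \<open>C\<close> accounts for \<open>x\<close> and \<open>K * C\<close> for \<open>h y\<close>.
    Adding the components gives the factor 2.\<close>
  define g where "g = (\<lambda>t. (1 + K) * C / (1 - \<alpha>) * t powr (1 - \<alpha>))"
  have g: "(g has_real_derivative (1 + K) * (C * r powr - \<alpha>)) (at r within S)" if "s \<le> r" for r S
    unfolding g_def using that assms t1 alpha
    by (auto intro!: derivative_eq_intros)
  have y_le: "\<bar>y r\<bar> \<le> (1 + K) * (C * r powr - \<alpha>)" if "s \<le> r" for r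
    using abs_le(2)[of r] that assms K_nonneg C_pos by (simp add: ring_distribs add_increasing2)
  have "\<bar>x t - x s\<bar> \<le> g t - g s"
    using assms x_deriv y_le g
    by (intro abs_diff_le_of_deriv_le[where f' = y]) (auto intro: DERIV_subset[OF _ subset_UNIV])
  moreover have "\<bar>y t - y s\<bar> \<le> g t - g s"
  proof (rule abs_diff_le_of_deriv_le[OF \<open>s \<le> t\<close>])
    fix r assume r: "s \<le> r"
    have "\<bar>h r\<bar> \<le> K"
      using h_le[of r] r assms t1 K_nonneg divide_left_mono[of 1 r K] by auto
    then have "\<bar>h r * y r\<bar> \<le> K * (C * r powr - \<alpha>)"
      unfolding abs_mult using abs_le(2)[of r] r assms K_nonneg by (intro mult_mono) auto
    then show "\<bar>- x r - h r * y r\<bar> \<le> (1 + K) * (C * r powr - \<alpha>)"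
      using abs_le(1)[of r] r assms by (simp add: ring_distribs)
    show "(y has_real_derivative - x r - h r * y r) (at r within {s..t})"
      using y_deriv[of r] r assms by (auto intro: DERIV_subset[OF _ subset_UNIV])
  qed (auto intro: g)
  ultimately have "dist (x s, y s) (x t, y t) \<le> 2 * (g t - g s)"
    using norm_Pair_le_abs[of "x s - x t" "y s - y t"] by (simp add: dist_norm abs_minus_commute)
  then show ?thesis
    by (simp add: g_def algebra_simps add_divide_distrib diff_divide_distrib)
qed

lemma measure_closed_nbhd_le:
  obtains A where "\<And>T. t\<^sub>1 \<le> T \<Longrightarrow>
    measure lebesgue (closed_nbhd \<Gamma> (T powr (- 1 - \<alpha>))) \<le> A * T powr (- 2 * \<alpha>)"
proof -
  define L where "L = 2 * (1 + K) * C / (1 - \<alpha>)"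
  have "measure lebesgue (closed_nbhd \<Gamma> (T powr (- 1 - \<alpha>)))
      \<le> (pi * (L + 2)\<^sup>2 * 2 + pi * (C + 2)\<^sup>2) * T powr (- 2 * \<alpha>)" if T: "t\<^sub>1 \<le> T" for T
  proof -
    have T_pos: "0 < T" "1 \<le> T" using T t1 by auto
    define \<epsilon> where "\<epsilon> = T powr (- 1 - \<alpha>)"
    have \<epsilon>: "0 < \<epsilon>" using T_pos by (simp add: \<epsilon>_def)
    have L: "0 \<le> L" using K_nonneg C_pos alpha by (simp add: L_def)
    \<comment> \<open>The curve in the parameter \<open>t powr (1 - \<alpha>)\<close>, in which it
      is Lipschitz with constant \<open>L\<close>.\<close>
    define f where "f = (\<lambda>s. (x (s powr (1 / (1 - \<alpha>))), y (s powr (1 / (1 - \<alpha>)))))"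
    have f_powr: "f (t powr (1 - \<alpha>)) = (x t, y t)" if "t\<^sub>1 \<le> t" for t
      using that t1 alpha by (simp add: f_def powr_powr)
    let ?a = "t\<^sub>1 powr (1 - \<alpha>)" and ?b = "T powr (1 - \<alpha>)"
    have "?a \<le> ?b" using T t1 alpha by (intro powr_mono2) auto
    moreover have "dist (f r) (f s) \<le> L * (s - r)" if "?a \<le> r" "r \<le> s" for r s
    proof -
      have "0 < r" using that t1 by (auto intro: less_le_trans[of 0 ?a])
      have "t\<^sub>1 = ?a powr (1 / (1 - \<alpha>))" using t1 alpha by (simp add: powr_powr)
      also have "\<dots> \<le> r powr (1 / (1 - \<alpha>))" using that alpha by (intro powr_mono2) auto
      finally have "t\<^sub>1 \<le> r powr (1 / (1 - \<alpha>))" .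
      moreover have "r powr (1 / (1 - \<alpha>)) \<le> s powr (1 / (1 - \<alpha>))"
        using that \<open>0 < r\<close> alpha by (intro powr_mono2) auto
      ultimately show ?thesis
        using dist_curve_le[of "r powr (1 / (1 - \<alpha>))" "s powr (1 / (1 - \<alpha>))"] alpha \<open>0 < r\<close> that
        by (simp add: f_def L_def powr_powr)
    qed
    ultimately obtain Q where Q: "finite Q" "real (card Q) \<le> (?b - ?a) / \<epsilon> + 1"
      "f ` {?a..?b} \<subseteq> (\<Union>q\<in>Q. cball q (L * \<epsilon>))"
      using lipschitz_image_cover[of ?a ?b \<epsilon> f L] L \<epsilon> by metis
    \<comment> \<open>Points of the neighbourhood are within \<open>2 * \<epsilon>\<close> of a
      curve point. This adds \<open>2 * \<epsilon>\<close> to the radius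
      \<open>L * \<epsilon>\<close> of the covering discs, and at most
      \<open>2 * T powr - \<alpha>\<close> to the radius of the disc around the tail.\<close>
    let ?U = "(\<Union>q\<in>Q. cball q ((L + 2) * \<epsilon>)) \<union> cball 0 ((C + 2) * T powr - \<alpha>)"
    have "\<epsilon> \<le> T powr - \<alpha>"
      unfolding \<epsilon>_def using T_pos by (intro powr_mono) auto
    have sub: "closed_nbhd \<Gamma> \<epsilon> \<subseteq> ?U"
    proof
      fix p assume "p \<in> closed_nbhd \<Gamma> \<epsilon>"
      then obtain t where t: "t\<^sub>1 \<le> t" "dist p (x t, y t) < 2 * \<epsilon>"
        using closed_nbhd_witness[OF _ curve_nonempty, of p \<epsilon> "2 * \<epsilon>"] \<epsilon>
        by (auto simp: solution_curve_def)
      show "p \<in> ?U"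
      proof (cases "t \<le> T")
        case True
        have "t powr (1 - \<alpha>) \<in> {?a..?b}"
          using t True t1 alpha by (auto intro!: powr_mono2)
        then have "(x t, y t) \<in> f ` {?a..?b}"
          using f_powr[OF t(1)] by (metis imageI)
        then obtain q where "q \<in> Q" "dist q (x t, y t) \<le> L * \<epsilon>"
          using Q(3) by auto
        then show ?thesis
          using t dist_triangle[of q p "(x t, y t)"]
          by (auto simp: dist_commute ring_distribs intro!: bexI[of _ q])
      next
        case False
        have "norm (x t, y t) \<le> C * T powr - \<alpha>"
          using False T_pos alpha C_pos
          by (intro order_trans[OF norm_le[OF t(1)]] mult_left_mono powr_mono2') auto
        then show ?thesis
          using t \<open>\<epsilon> \<le> T powr - \<alpha>\<close> norm_triangle_ineq[of "p - (x t, y t)" "(x t, y t)"]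
          by (simp add: dist_norm ring_distribs)
      qed
    qed
    have "measure lebesgue (\<Union>q\<in>Q. cball q ((L + 2) * \<epsilon>))
        \<le> (\<Sum>q\<in>Q. measure lebesgue (cball q ((L + 2) * \<epsilon>)))"
      using Q(1) by (intro measure_UNION_le) auto
    also have "\<dots> = real (card Q) * (pi * ((L + 2) * \<epsilon>)\<^sup>2)"
      using L \<epsilon> by (subst sum.cong[OF refl measure_cball_plane]) auto
    also have "\<dots> \<le> (T powr (1 - \<alpha>) / \<epsilon> + 1) * (pi * ((L + 2) * \<epsilon>)\<^sup>2)"
      using \<epsilon> powr_ge_zero[of t\<^sub>1 "1 - \<alpha>"]
      by (intro mult_right_mono order_trans[OF Q(2)] add_right_mono divide_right_mono) auto
    also have "\<dots> = pi * (L + 2)\<^sup>2 * (T powr (1 - \<alpha>) * \<epsilon> + \<epsilon> * \<epsilon>)"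
      using \<epsilon> by (simp add: field_simps power2_eq_square)
    also have "\<dots> \<le> pi * (L + 2)\<^sup>2 * (2 * T powr (- 2 * \<alpha>))"
    proof -
      \<comment> \<open>The term \<open>T powr (1 - \<alpha>) * \<epsilon>\<close> equals
        \<open>T powr (- 2 * \<alpha>)\<close>; the square of \<epsilon>, coming from the extra disc
        in the count, is no larger since \<open>T \<ge> 1\<close>.\<close>
      have "\<epsilon> * \<epsilon> \<le> T powr (- 2 * \<alpha>)"
        unfolding \<epsilon>_def powr_add[symmetric] using T_pos by (intro powr_mono) auto
      then have "T powr (1 - \<alpha>) * \<epsilon> + \<epsilon> * \<epsilon> \<le> 2 * T powr (- 2 * \<alpha>)"
        by (simp add: \<epsilon>_def flip: powr_add)
      then show ?thesis by (intro mult_left_mono) auto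
    qed
    finally have balls: "measure lebesgue (\<Union>q\<in>Q. cball q ((L + 2) * \<epsilon>))
        \<le> pi * (L + 2)\<^sup>2 * (2 * T powr (- 2 * \<alpha>))" .
    have disc: "measure lebesgue (cball (0::real\<times>real) ((C + 2) * T powr - \<alpha>))
        = pi * (C + 2)\<^sup>2 * T powr (- 2 * \<alpha>)"
      using C_pos by (subst measure_cball_plane) (auto simp: power_mult_distrib powr_square)
    have "measure lebesgue (closed_nbhd \<Gamma> \<epsilon>) \<le> measure lebesgue ?U"
      using sub Q(1) by (intro measure_mono_fmeasurable)
        (auto intro!: fmeasurable.Un fmeasurable.finite_UN borel_closed closed_closed_nbhd)
    also have "\<dots> \<le> measure lebesgue (\<Union>q\<in>Q. cball q ((L + 2) * \<epsilon>))
        + measure lebesgue (cball (0::real\<times>real) ((C + 2) * T powr - \<alpha>))"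
      using Q(1) by (intro measure_Un_le) auto
    also have "\<dots> \<le> pi * (L + 2)\<^sup>2 * (2 * T powr (- 2 * \<alpha>)) + pi * (C + 2)\<^sup>2 * T powr (- 2 * \<alpha>)"
      using balls disc by linarith
    also have "\<dots> = (pi * (L + 2)\<^sup>2 * 2 + pi * (C + 2)\<^sup>2) * T powr (- 2 * \<alpha>)"
      by (simp add: ring_distribs)
    finally show ?thesis
      by (simp only: \<epsilon>_def)
  qed
  then show ?thesis using that by blast
qed

text \<open>The estimates indexed by \<open>T\<close> become estimates in \<epsilon>: the upper one
  with \<open>T powr (- 1 - \<alpha>) = \<epsilon>\<close>, the lower one with
  \<open>D * T powr (- 1 - \<alpha>) = \<epsilon>\<close>.\<close>

theorem has_box_dim: "has_box_dim \<Gamma> (2 / (1 + \<alpha>))"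
proof -
  define \<beta> where "\<beta> = 2 * \<alpha> / (1 + \<alpha>)"
  \<comment> \<open>The summand 1 keeps \<open>D\<close> positive even if
    \<open>K = 0\<close>.\<close>
  define D where "D = 8 * pi * K * C + 1"
  have D: "0 < D" using K_nonneg C_pos by (simp add: D_def add_nonneg_pos)
  \<comment> \<open>Solves \<open>T powr (- 1 - \<alpha>) = \<delta>\<close> for \<open>T\<close>;
    the bound on \<delta> ensures that \<open>T\<close> is at least
    \<open>t\<^sub>1\<close>.\<close>
  have time: "t\<^sub>1 \<le> \<delta> powr (- 1 / (1 + \<alpha>))"
    "(\<delta> powr (- 1 / (1 + \<alpha>))) powr (- 1 - \<alpha>) = \<delta>"
    "(\<delta> powr (- 1 / (1 + \<alpha>))) powr (- 2 * \<alpha>) = \<delta> powr \<beta>"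
    if "0 < \<delta>" "\<delta> \<le> t\<^sub>1 powr (- 1 - \<alpha>)" for \<delta>
  proof -
    have inv: "- 1 / (1 + \<alpha>) * (- 1 - \<alpha>) = 1"
      using alpha by (simp add: field_simps)
    then have "t\<^sub>1 = (t\<^sub>1 powr (- 1 - \<alpha>)) powr (- 1 / (1 + \<alpha>))"
      using t1 by (simp only: powr_powr mult.commute[of "- 1 - \<alpha>"]) simp
    also have "\<dots> \<le> \<delta> powr (- 1 / (1 + \<alpha>))"
      using that alpha by (intro powr_mono2') auto
    finally show "t\<^sub>1 \<le> \<delta> powr (- 1 / (1 + \<alpha>))" .
    show "(\<delta> powr (- 1 / (1 + \<alpha>))) powr (- 1 - \<alpha>) = \<delta>"
      using that by (simp only: powr_powr inv) simp
    show "(\<delta> powr (- 1 / (1 + \<alpha>))) powr (- 2 * \<alpha>) = \<delta> powr \<beta>"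
      by (simp add: powr_powr \<beta>_def)
  qed
  obtain A where A: "\<And>T. t\<^sub>1 \<le> T \<Longrightarrow>
      measure lebesgue (closed_nbhd \<Gamma> (T powr (- 1 - \<alpha>))) \<le> A * T powr (- 2 * \<alpha>)"
    using measure_closed_nbhd_le by blast
  have ge: "pi * c\<^sup>2 * (\<epsilon> / D) powr \<beta> \<le> measure lebesgue (closed_nbhd \<Gamma> \<epsilon>)"
    if "0 < \<epsilon>" "\<epsilon> / D \<le> t\<^sub>1 powr (- 1 - \<alpha>)" for \<epsilon>
  proof -
    define T where "T = (\<epsilon> / D) powr (- 1 / (1 + \<alpha>))"
    have T: "t\<^sub>1 \<le> T" "D * T powr (- 1 - \<alpha>) = \<epsilon>" "T powr (- 2 * \<alpha>) = (\<epsilon> / D) powr \<beta>"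
      unfolding T_def using time[of "\<epsilon> / D"] that D by simp_all
    have "pi * c\<^sup>2 * (\<epsilon> / D) powr \<beta> = measure lebesgue (cball (0::real\<times>real) (c * T powr - \<alpha>))"
      using c_pos by (subst measure_cball_plane) (auto simp: power_mult_distrib powr_square simp flip: T(3))
    also have "\<dots> \<le> measure lebesgue (closed_nbhd \<Gamma> \<epsilon>)"
      using cball_subset_closed_nbhd[OF T(1), of D] T(2) D
      by (intro measure_mono_fmeasurable closed_nbhd_lmeasurable curve_bounded curve_nonempty)
        (auto simp: D_def)
    finally show ?thesis .
  qed
  have "has_box_dim \<Gamma> (2 - \<beta>)"
  proof (rule has_box_dim_of_measure_powr_bounds[OF curve_bounded])
    show "0 < pi * c\<^sup>2 * (1 / D) powr \<beta>"
      using c_pos D by simp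
    \<comment> \<open>Below this threshold both \<epsilon> and \<open>\<epsilon> / D\<close> are
      admissible values of \<delta>.\<close>
    let ?e = "min 1 D * t\<^sub>1 powr (- 1 - \<alpha>)"
    have "0 < ?e" using t1 D by simp
    moreover have "pi * c\<^sup>2 * (1 / D) powr \<beta> * \<epsilon> powr \<beta> \<le> measure lebesgue (closed_nbhd \<Gamma> \<epsilon>) \<and>
        measure lebesgue (closed_nbhd \<Gamma> \<epsilon>) \<le> A * \<epsilon> powr \<beta>" if "0 < \<epsilon>" "\<epsilon> < ?e" for \<epsilon>
    proof -
      have "?e \<le> 1 * t\<^sub>1 powr (- 1 - \<alpha>)" "?e \<le> D * t\<^sub>1 powr (- 1 - \<alpha>)"
        by (intro mult_right_mono; simp)+
      then have e: "\<epsilon> \<le> t\<^sub>1 powr (- 1 - \<alpha>)" "\<epsilon> / D \<le> t\<^sub>1 powr (- 1 - \<alpha>)"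
        using that D by (simp_all add: field_simps)
      have "measure lebesgue (closed_nbhd \<Gamma> \<epsilon>) \<le> A * \<epsilon> powr \<beta>"
        using A[OF time(1)[OF that(1) e(1)]] time(2,3)[OF that(1) e(1)] by simp
      moreover have "(\<epsilon> / D) powr \<beta> = (1 / D) powr \<beta> * \<epsilon> powr \<beta>"
        using that D by (simp flip: powr_mult)
      ultimately show ?thesis
        using ge[OF that(1) e(2)] by (simp add: mult.assoc)
    qed
    ultimately show "\<forall>\<^sub>F \<epsilon> in at_right 0.
        pi * c\<^sup>2 * (1 / D) powr \<beta> * \<epsilon> powr \<beta> \<le> measure lebesgue (closed_nbhd \<Gamma> \<epsilon>) \<and>
        measure lebesgue (closed_nbhd \<Gamma> \<epsilon>) \<le> A * \<epsilon> powr \<beta>"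
      unfolding eventually_at_right_field by blast
  qed
  moreover have "2 - \<beta> = 2 / (1 + \<alpha>)"
    using alpha by (simp add: \<beta>_def field_simps)
  ultimately show ?thesis by simp
qed

end

section \<open>Energy estimate\<close>

text \<open>Up to the factor \<open>exp (H t / 2)\<close>, the pair \<open>(x, y + h x / 2)\<close> is \<open>(u, u')\<close> for a solution
  of \<open>u'' + (1 - g / 4) u = 0\<close> with \<open>g = 2 h' + h\<^sup>2\<close>; as \<open>g\<close> is integrable, its energy stays
  between two positive constants.\<close>

lemma energy_bounds:
  fixes t0 :: real and h h' H x y :: "real \<Rightarrow> real"
  defines "F \<equiv> \<lambda>t. exp (H t) * ((x t)\<^sup>2 + (y t + h t * x t / 2)\<^sup>2)"
  assumes h: "\<And>t. t0 \<le> t \<Longrightarrow> (h has_real_derivative h' t) (at t within {t0..})"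
    and h': "continuous_on {t0..} h'"
    and H: "\<And>t. t0 \<le> t \<Longrightarrow> H t = integral {t0..t} h"
    and abs_int: "(\<lambda>t. 2 * h' t + \<bar>h t\<bar>\<^sup>2) absolutely_integrable_on {t0..}"
    and sol: "is_solution t0 h x y" and nontriv: "nontrivial t0 x y"
  obtains m M where "0 < m" "\<And>t. t0 \<le> t \<Longrightarrow> m \<le> F t" "\<And>t. t0 \<le> t \<Longrightarrow> F t \<le> M"
proof -
  define g where "g = (\<lambda>t. \<bar>2 * h' t + (h t)\<^sup>2\<bar>)"
  define G where "G = (\<lambda>t. integral {t0..t} g)"
  define I where "I = integral {t0..} g"
  \<comment> \<open>With \<open>w = y + h x / 2\<close>, the products \<open>x w\<close> from the
    undamped motion cancel in the derivative of \<open>F\<close>, and so do the terms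
    \<open>h (x\<^sup>2 + w\<^sup>2)\<close>; only a multiple of \<open>2 h' + h\<^sup>2\<close>
    remains.\<close>
  define F' where "F' = (\<lambda>t. exp (H t) * x t * (y t + h t * x t / 2) * (2 * h' t + (h t)\<^sup>2) / 2)"
  have F_nonneg: "0 \<le> F t" for t by (simp add: F_def)
  have h_cont: "continuous_on {t0..} h"
    by (rule DERIV_continuous_on) (use h in auto)
  have g_cont: "continuous_on {t0..} g"
    unfolding g_def by (intro continuous_intros h' h_cont)
  have g_int: "g integrable_on {t0..}"
    using abs_int unfolding absolutely_integrable_on_def g_def by simp
  have G_le: "0 \<le> G t" "G t \<le> I" if "t0 \<le> t" for t
  proof -
    have "g integrable_on {t0..t}"
      by (intro integrable_continuous_real continuous_on_subset[OF g_cont]) auto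
    then show "0 \<le> G t" "G t \<le> I"
      unfolding G_def I_def using g_int
      by (auto intro!: integral_nonneg integral_subset_le simp: g_def)
  qed
  have deriv: "(H has_real_derivative h t) (at t within {t0..b})"
    "(G has_real_derivative g t) (at t within {t0..b})"
    "(F has_real_derivative F' t) (at t within {t0..b})"
    if "t0 \<le> t" "t \<le> b" for t b
  proof -
    have "((\<lambda>t. integral {t0..t} h) has_real_derivative h t) (at t within {t0..b})"
      using that by (intro integral_has_real_derivative continuous_on_subset[OF h_cont]) auto
    then show H': "(H has_real_derivative h t) (at t within {t0..b})"
      unfolding has_field_derivative_def
      by (rule has_derivative_transform[rotated 2]) (use that H in auto)
    show "(G has_real_derivative g t) (at t within {t0..b})"
      unfolding G_def
      using that by (intro integral_has_real_derivative continuous_on_subset[OF g_cont]) auto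
    have "(h has_real_derivative h' t) (at t within {t0..b})"
      "(x has_real_derivative y t) (at t within {t0..b})"
      "(y has_real_derivative - x t - h t * y t) (at t within {t0..b})"
      using h[of t] sol that unfolding is_solution_def
      by (auto intro: DERIV_subset[where s = "{t0..}"])
    then show "(F has_real_derivative F' t) (at t within {t0..b})"
      unfolding F_def F'_def using H'
      by (auto intro!: derivative_eq_intros) (simp add: field_simps power2_eq_square)
  qed
  have F'_le: "\<bar>F' t\<bar> \<le> g t * F t / 4" for t
  proof -
    have "2 * \<bar>a * b\<bar> \<le> a\<^sup>2 + b\<^sup>2" for a b :: real
      using sum_squares_bound[of "\<bar>a\<bar>" "\<bar>b\<bar>"] by (simp add: abs_mult)
    from mult_left_mono[OF this, of "exp (H t) * g t / 4" "x t" "y t + h t * x t / 2"]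
    have "exp (H t) * g t / 4 * (2 * \<bar>x t * (y t + h t * x t / 2)\<bar>) \<le> g t * F t / 4"
      by (simp add: F_def g_def mult_ac)
    also have "exp (H t) * g t / 4 * (2 * \<bar>x t * (y t + h t * x t / 2)\<bar>) = \<bar>F' t\<bar>"
      by (simp add: F'_def g_def abs_mult)
    finally show ?thesis .
  qed
  \<comment> \<open>Gronwall's argument in both directions, from
    \<open>\<bar>F'\<bar> \<le> g F / 4\<close>. Since \<open>G\<close> stays between 0 and
    \<open>I\<close>, both exponential factors are bounded and bounded away from 0.\<close>
  have mono: "exp (G a / 4) * F a \<le> exp (G b / 4) * F b"
    "exp (- G b / 4) * F b \<le> exp (- G a / 4) * F a" if "t0 \<le> a" "a \<le> b" for a b
  proof -
    have FG: "(F has_real_derivative F' t) (at t within {a..b})"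
      "(G has_real_derivative g t) (at t within {a..b})" if "a \<le> t" "t \<le> b" for t
      using deriv(2,3)[of t b] that \<open>t0 \<le> a\<close> by (auto intro: DERIV_subset[where s = "{t0..b}"])
    have "\<bar>0 - 0\<bar> \<le> exp (G b / 4) * F b - exp (G a / 4) * F a"
    proof (rule abs_diff_le_of_deriv_le[OF \<open>a \<le> b\<close>, where f = "\<lambda>_. 0" and f' = "\<lambda>_. 0"])
      fix t assume t: "a \<le> t" "t \<le> b"
      show "((\<lambda>t. exp (G t / 4) * F t) has_real_derivative exp (G t / 4) * (g t * F t / 4 + F' t))
          (at t within {a..b})"
        using FG[OF t] by (auto intro!: derivative_eq_intros simp: algebra_simps)
      show "\<bar>0\<bar> \<le> exp (G t / 4) * (g t * F t / 4 + F' t)"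
        using F'_le[of t] by auto
    qed auto
    then show "exp (G a / 4) * F a \<le> exp (G b / 4) * F b" by simp
    have "\<bar>0 - 0\<bar> \<le> - (exp (- G b / 4) * F b) - (- (exp (- G a / 4) * F a))"
    proof (rule abs_diff_le_of_deriv_le[OF \<open>a \<le> b\<close>, where f = "\<lambda>_. 0" and f' = "\<lambda>_. 0"])
      fix t assume t: "a \<le> t" "t \<le> b"
      show "((\<lambda>t. - (exp (- G t / 4) * F t)) has_real_derivative
          exp (- G t / 4) * (g t * F t / 4 - F' t)) (at t within {a..b})"
        using FG[OF t] by (auto intro!: derivative_eq_intros simp: algebra_simps)
      show "\<bar>0\<bar> \<le> exp (- G t / 4) * (g t * F t / 4 - F' t)"
        using F'_le[of t] by auto
    qed auto
    then show "exp (- G b / 4) * F b \<le> exp (- G a / 4) * F a" by simp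
  qed
  have G0: "G t0 = 0" by (simp add: G_def)
  \<comment> \<open>Nontriviality gives a nonzero state only at some time \<open>s\<close>; the
    second monotonicity carries positivity of \<open>F\<close> back to \<open>t0\<close>.\<close>
  obtain s where s: "t0 \<le> s" "x s \<noteq> 0 \<or> y s \<noteq> 0"
    using nontriv by (auto simp: nontrivial_def)
  then have "0 < (x s)\<^sup>2 + (y s + h s * x s / 2)\<^sup>2"
    by (auto simp: sum_power2_gt_zero_iff)
  then have "0 < exp (- G s / 4) * F s"
    by (simp add: F_def)
  then have F0: "0 < F t0"
    using mono(2)[OF order_refl s(1)] G0 by simp
  show thesis
  proof (rule that)
    show "0 < exp (- I / 4) * F t0" using F0 by simp
    fix t assume t: "t0 \<le> t"
    have "F t0 \<le> exp (G t / 4) * F t"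
      using mono(1)[OF order_refl t] G0 by simp
    also have "\<dots> \<le> exp (I / 4) * F t"
      using G_le[OF t] F_nonneg by (intro mult_right_mono) auto
    finally show "exp (- I / 4) * F t0 \<le> F t"
      by (simp add: exp_minus field_simps)
    have "exp (- I / 4) * F t \<le> exp (- G t / 4) * F t"
      using G_le[OF t] F_nonneg by (intro mult_right_mono) auto
    also have "\<dots> \<le> F t0"
      using mono(2)[OF order_refl t] G0 by simp
    finally show "F t \<le> exp (I / 4) * F t0"
      by (simp add: exp_minus field_simps)
  qed
qed

section \<open>From the linear system to the spiral\<close>

text \<open>The shear by \<open>k\<close> has the shear by \<open>- k\<close> as inverse, so this
  one inequality compares the two quadratic forms in both directions.\<close>

lemma sum_squares_shear_le:
  fixes a b k :: real
  assumes "\<bar>k\<bar> \<le> 1"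
  shows "a\<^sup>2 + (b + k * a / 2)\<^sup>2 \<le> 2 * (a\<^sup>2 + b\<^sup>2)"
proof -
  have "k\<^sup>2 * a\<^sup>2 \<le> 1 * a\<^sup>2"
    using assms by (intro mult_right_mono) (simp_all add: abs_square_le_1)
  then have "0 \<le> (b - k * a / 2)\<^sup>2 + (a\<^sup>2 - k\<^sup>2 * a\<^sup>2) / 2 + a\<^sup>2 / 2"
    by simp
  also have "\<dots> = 2 * (a\<^sup>2 + b\<^sup>2) - (a\<^sup>2 + (b + k * a / 2)\<^sup>2)"
    by (simp add: field_simps power2_eq_square)
  finally show ?thesis by simp
qed

theorem theorem1p1:
  fixes t0 \<alpha> :: real and h h' H :: "real \<Rightarrow> real"
  assumes h_deriv: "\<And>t. t \<ge> t0 \<Longrightarrow> (h has_real_derivative h' t) (at t within {t0..})"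
    and h'_cont: "continuous_on {t0..} h'"
    and h_pos: "\<And>t. t \<ge> t0 \<Longrightarrow> h t > 0"
    and H_eq: "\<And>t. t \<ge> t0 \<Longrightarrow> H t = integral {t0..t} h"
    and abs_int: "(\<lambda>t. 2 * h' t + \<bar>h t\<bar>\<^sup>2) absolutely_integrable_on {t0..}"
    and limsup_th: "Limsup at_top (\<lambda>t. ereal (t * h t)) < \<infinity>"
    and alpha: "\<alpha> \<in> {0<..<1}"
    and H_asymp: "(\<lambda>t. H t - 2 * \<alpha> * ln t) \<in> O[at_top](\<lambda>_. 1)"
  shows "\<forall>x y. is_solution t0 h x y \<and> nontrivial t0 x y \<longrightarrow>
           (\<exists>t1\<ge>t0. has_box_dim (solution_curve x y t1) (2 / (1 + \<alpha>)))"
proof (intro allI impI, elim conjE)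
  fix x y assume sol: "is_solution t0 h x y" and nontriv: "nontrivial t0 x y"
  obtain m M where mM: "0 < m"
    "\<And>t. t0 \<le> t \<Longrightarrow> m \<le> exp (H t) * ((x t)\<^sup>2 + (y t + h t * x t / 2)\<^sup>2)"
    "\<And>t. t0 \<le> t \<Longrightarrow> exp (H t) * ((x t)\<^sup>2 + (y t + h t * x t / 2)\<^sup>2) \<le> M"
    using energy_bounds[OF h_deriv h'_cont H_eq abs_int sol nontriv] by blast
  have "0 < M" using mM(1) mM(2,3)[of t0] by linarith
  obtain K where "Limsup at_top (\<lambda>t. ereal (t * h t)) < ereal K"
    using ereal_dense2[OF limsup_th] by blast
  then have "\<forall>\<^sub>F t in at_top. t * h t < K"
    by (auto dest: Limsup_lessD)
  moreover obtain B where "\<forall>\<^sub>F t in at_top. \<bar>H t - 2 * \<alpha> * ln t\<bar> \<le> B"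
    using H_asymp by (auto elim!: landau_o.bigE)
  \<comment> \<open>The bound \<open>t0 + 1\<close> makes later times interior to the domain, so
    derivatives become two-sided; 1 is the starting bound of the spiral; \<open>K\<close> yields
    \<open>h t \<le> K / t \<le> 1\<close>, as the shear comparison requires.\<close>
  moreover note eventually_ge_at_top[of "max (t0 + 1) (max 1 K)"]
  ultimately have "\<forall>\<^sub>F t in at_top. t * h t < K \<and> \<bar>H t - 2 * \<alpha> * ln t\<bar> \<le> B \<and>
      max (t0 + 1) (max 1 K) \<le> t"
    by eventually_elim auto
  then obtain t1 where t1: "\<And>t. t1 \<le> t \<Longrightarrow> t * h t < K \<and> \<bar>H t - 2 * \<alpha> * ln t\<bar> \<le> B \<and>
      max (t0 + 1) (max 1 K) \<le> t"
    by (auto simp: eventually_at_top_linorder)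
  have t1_ge: "1 \<le> t1" "t0 + 1 \<le> t1" "K \<le> t1" using t1[of t1] by auto
  have h_le: "\<bar>h t\<bar> \<le> K / t" "\<bar>h t\<bar> \<le> 1" if "t1 \<le> t" for t
  proof -
    have "0 < h t" "0 < t" using h_pos[of t] t1_ge that by auto
    then show "\<bar>h t\<bar> \<le> K / t" using t1[OF that] by (simp add: field_simps)
    also have "\<dots> \<le> 1" using t1_ge that by simp
    finally show "\<bar>h t\<bar> \<le> 1" .
  qed
  have sq_bounds: "m / 2 * exp (- B) * t powr (- 2 * \<alpha>) \<le> (x t)\<^sup>2 + (y t)\<^sup>2"
    "(x t)\<^sup>2 + (y t)\<^sup>2 \<le> 2 * M * exp B * t powr (- 2 * \<alpha>)" if "t1 \<le> t" for t
  proof -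
    let ?r = "(x t)\<^sup>2 + (y t)\<^sup>2" and ?q = "(x t)\<^sup>2 + (y t + h t * x t / 2)\<^sup>2"
    have t: "t0 \<le> t" "0 < t" using that t1_ge by auto
    \<comment> \<open>The second inequality applies the inverse shear to
      \<open>y t + h t * x t / 2\<close>.\<close>
    have rq: "?q \<le> 2 * ?r" "?r \<le> 2 * ?q"
      using sum_squares_shear_le[of "h t" "x t" "y t"] h_le(2)[OF that]
        sum_squares_shear_le[of "- h t" "x t" "y t + h t * x t / 2"] by auto
    have P: "t powr (- 2 * \<alpha>) = exp (- (2 * \<alpha> * ln t))"
      using t by (simp add: powr_def)
    have "\<bar>H t - 2 * \<alpha> * ln t\<bar> \<le> B" using t1[OF that] by blast
    then have e: "exp (- B) * t powr (- 2 * \<alpha>) \<le> exp (- H t)"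
      "exp (- H t) \<le> exp B * t powr (- 2 * \<alpha>)"
      unfolding P exp_add[symmetric] by auto
    have "m / 2 * (exp (- B) * t powr (- 2 * \<alpha>)) \<le> m / 2 * exp (- H t)"
      using e mM(1) by (intro mult_left_mono) auto
    also have "\<dots> \<le> ?q / 2"
      using mM(2)[OF t(1)] by (simp add: exp_minus field_simps)
    finally show "m / 2 * exp (- B) * t powr (- 2 * \<alpha>) \<le> ?r"
      using rq by (simp add: mult.assoc)
    have "?q \<le> M * exp (- H t)"
      using mM(3)[OF t(1)] by (simp add: exp_minus field_simps)
    also have "\<dots> \<le> M * (exp B * t powr (- 2 * \<alpha>))"
      using e \<open>0 < M\<close> by (intro mult_left_mono) auto
    finally show "?r \<le> 2 * M * exp B * t powr (- 2 * \<alpha>)"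
      using rq by (simp add: mult.assoc)
  qed
  have at: "at t within {t0..} = at t" if "t1 \<le> t" for t
    using that t1_ge by (intro at_within_interior) simp
  have sqrt_powr: "sqrt (a * t powr (- 2 * \<alpha>)) = sqrt a * t powr - \<alpha>" for a t
    by (simp add: real_sqrt_mult powr_half_sqrt[symmetric] powr_powr)
  interpret damped_spiral x y h t1 \<alpha> "sqrt (m / 2 * exp (- B))" "sqrt (2 * M * exp B)" K
  proof
    fix t assume t: "t1 \<le> t"
    have "t0 \<le> t" using t t1_ge by linarith
    then have "(x has_real_derivative y t) (at t within {t0..}) \<and>
        (y has_real_derivative - x t - h t * y t) (at t within {t0..})"
      using sol by (simp add: is_solution_def)
    then show "(x has_real_derivative y t) (at t)"
      "(y has_real_derivative - x t - h t * y t) (at t)"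
      unfolding at[OF t] by auto
    show "sqrt (m / 2 * exp (- B)) * t powr - \<alpha> \<le> norm (x t, y t)"
      "norm (x t, y t) \<le> sqrt (2 * M * exp B) * t powr - \<alpha>"
      unfolding norm_Pair sqrt_powr[symmetric] using sq_bounds[OF t] by simp_all
  qed (use alpha t1_ge mM(1) h_le in auto)
  show "\<exists>t1\<ge>t0. has_box_dim (solution_curve x y t1) (2 / (1 + \<alpha>))"
    using has_box_dim t1_ge by (intro exI[of _ t1]) auto
qed

end
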